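(* Let $G$ be a finitely generated group, let $H\leq G$ be a subgroup of finite index, and suppose that $G$ is the disjoint union $G=\bigcup_{i=1}^n Hb_i$ with $b_1,\ldots,b_n\in G$. Then $\mathrm{CF}(G)$ consists of exactly all subsets of the form $$\bigcup_{i=1}^{n} L_ib_i,\qquad L_i\in \mathrm{CF}(H)\ (i=1,\ldots,n).$$
   Context: For a finitely generated group $G$ with finite generating set $A$, let $\tilde A=A\cup A^{-1}$ (formal inverses) and let $\pi:\tilde A^*\to G$ be the canonical surjective monoid homomorphism. A subset $K\subseteq G$ is called context-free if its full preimage $K\pi^{-1}\subseteq \tilde A^*$ is a context-free language; $\mathrm{CF}(G)$ denotes the class of all context-free subsets of $G$. (This class does not depend on the choice of finite generating set.) *)

theory Defs
  imports "HOL-Algebra.Algebra"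
begin

section \<open>Context-free languages\<close>

text \<open>
  A symbol is \<open>Inl A\<close> for a nonterminal \<open>A\<close> and \<open>Inr a\<close> for a terminal \<open>a\<close>;
  a production \<open>(A, \<alpha>)\<close> stands for \<open>A \<rightarrow> \<alpha>\<close>.
\<close>

type_synonym ('n, 't) prods = "('n \<times> ('n + 't) list) set"

inductive derive1 :: "('n, 't) prods \<Rightarrow> ('n + 't) list \<Rightarrow> ('n + 't) list \<Rightarrow> bool"
  for P where
  "(A, \<alpha>) \<in> P \<Longrightarrow> derive1 P (u @ [Inl A] @ v) (u @ \<alpha> @ v)"

definition cfg_language :: "('n, 't) prods \<Rightarrow> 'n \<Rightarrow> 't list set" where
  "cfg_language P S = {w. (derive1 P)\<^sup>*\<^sup>* [Inl S] (map Inr w)}"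

text \<open>
  A finite grammar uses only finitely many nonterminals, so there is no loss of generality
  in naming them by natural numbers.
\<close>

definition context_free_language :: "'t set \<Rightarrow> 't list set \<Rightarrow> bool" where
  "context_free_language \<Sigma> L \<longleftrightarrow>
     finite \<Sigma> \<and>
     (\<exists>(P :: (nat, 't) prods) S.
        finite P \<and> (\<forall>(A, \<alpha>) \<in> P. set \<alpha> \<subseteq> UNIV <+> \<Sigma>) \<and> L = cfg_language P S)"


section \<open>Context-free subsets of a finitely generated group\<close>

text \<open>Inverses are formal: \<open>Neg a\<close> is never identified with a letter \<open>Pos b\<close>.\<close>

datatype 'a letter = Pos 'a | Neg 'a

definition letters :: "'a set \<Rightarrow> 'a letter set" where
  "letters A = Pos ` A \<union> Neg ` A"

primrec letter_val :: "('a, 'm) monoid_scheme \<Rightarrow> 'a letter \<Rightarrow> 'a" where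
  "letter_val G (Pos a) = a"
| "letter_val G (Neg a) = inv\<^bsub>G\<^esub> a"

primrec word_val :: "('a, 'm) monoid_scheme \<Rightarrow> 'a letter list \<Rightarrow> 'a" where
  "word_val G [] = \<one>\<^bsub>G\<^esub>"
| "word_val G (x # w) = letter_val G x \<otimes>\<^bsub>G\<^esub> word_val G w"

definition fin_gen_set :: "('a, 'm) monoid_scheme \<Rightarrow> 'a set \<Rightarrow> bool" where
  "fin_gen_set G A \<longleftrightarrow> finite A \<and> A \<subseteq> carrier G \<and> generate G A = carrier G"

definition finitely_generated :: "('a, 'm) monoid_scheme \<Rightarrow> bool" where
  "finitely_generated G \<longleftrightarrow> (\<exists>A. fin_gen_set G A)"

definition word_preimage :: "('a, 'm) monoid_scheme \<Rightarrow> 'a set \<Rightarrow> 'a set \<Rightarrow> 'a letter list set" where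
  "word_preimage G A K = {w \<in> lists (letters A). word_val G w \<in> K}"

text \<open>
  For a group \<open>G\<close> the choice of the finite generating set \<open>A\<close> is immaterial, because
  context-free languages are closed under inverse homomorphisms. If \<open>G\<close> is not finitely
  generated, then \<open>CF G\<close> is empty.
\<close>

definition CF :: "('a, 'm) monoid_scheme \<Rightarrow> 'a set set" where
  "CF G = {K. K \<subseteq> carrier G \<and>
     (\<exists>A. fin_gen_set G A \<and> context_free_language (letters A) (word_preimage G A K))}"

end

theory Submission
  imports Defs
begin

text \<open>
  Context-free languages are closed under finite unions and under images of finite transducers
  (triple construction on grammars), hence under preimages of sequential functions. Both
  inclusions are instances of the latter. For \<open>K \<in> CF(G)\<close> put \<open>L\<^sub>i = {h \<in> H. h b\<^sub>i \<in> K}\<close>: a word \<open>w\<close>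
  over generators of \<open>H\<close> (finitely many by Schreier's lemma) represents an element of \<open>L\<^sub>i\<close> iff \<open>w\<close>,
  rewritten over the generators of \<open>G\<close> and followed by a word for \<open>b\<^sub>i\<close>, represents an element of
  \<open>K\<close>. Conversely, the automaton of cosets, which on a letter \<open>x\<close> moves from \<open>H b\<^sub>i\<close> to
  \<open>H b\<^sub>j = H b\<^sub>i x\<close> and outputs a word for \<open>b\<^sub>i x b\<^sub>j\<^sup>-\<^sup>1 \<in> H\<close>, recognizes whether a word over the
  generators of \<open>G\<close> represents an element of \<open>L\<^sub>i b\<^sub>i\<close>.
\<close>

section \<open>Context-free languages\<close>

text \<open>Each nonterminal is replaced at once by the whole terminal word derived from it.
  Inductions can then follow the shape of the derivation trees instead of a sequence of rewriting
  steps.\<close>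

inductive yields :: "('n, 't) prods \<Rightarrow> ('n + 't) list \<Rightarrow> 't list \<Rightarrow> bool" for P where
  yields_Nil: "yields P [] []"
| yields_Inr: "yields P \<alpha> w \<Longrightarrow> yields P (Inr t # \<alpha>) (t # w)"
| yields_Inl: "(A, \<gamma>) \<in> P \<Longrightarrow> yields P \<gamma> u \<Longrightarrow> yields P \<alpha> w \<Longrightarrow> yields P (Inl A # \<alpha>) (u @ w)"

inductive_cases yields_InlE: "yields P (Inl A # \<alpha>) w"
inductive_cases yields_InrE: "yields P (Inr t # \<alpha>) w"

lemma yields_append: "yields P \<alpha> u \<Longrightarrow> yields P \<beta> v \<Longrightarrow> yields P (\<alpha> @ \<beta>) (u @ v)"
  by (induction rule: yields.induct) (auto intro: yields.intros)

text \<open>Neighbouring symbols derive independently. This cuts a derived word around the place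
  where a rewriting step is applied.\<close>

lemma yields_append_split:
  "yields P (\<alpha> @ \<beta>) w \<Longrightarrow> \<exists>u v. w = u @ v \<and> yields P \<alpha> u \<and> yields P \<beta> v"
proof (induction \<alpha> arbitrary: w)
  case Nil
  then show ?case by (auto intro: yields_Nil)
next
  case (Cons Z \<alpha>)
  show ?case
  proof (cases Z)
    case (Inl A)
    with Cons.prems obtain \<gamma> u w' where "(A, \<gamma>) \<in> P" "yields P \<gamma> u" "yields P (\<alpha> @ \<beta>) w'" "w = u @ w'"
      by (auto elim: yields_InlE)
    with Cons.IH[of w'] Inl show ?thesis
      by (metis append.assoc yields_Inl)
  next
    case (Inr t)
    with Cons.prems obtain w' where "yields P (\<alpha> @ \<beta>) w'" "w = t # w'"
      by (auto elim: yields_InrE)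
    with Cons.IH[of w'] Inr show ?thesis
      by (metis append_Cons yields_Inr)
  qed
qed

lemma yields_map_Inr: "yields P (map Inr w) w"
  by (induction w) (auto intro: yields.intros)

lemma yields_single: "(A, \<gamma>) \<in> P \<Longrightarrow> yields P \<gamma> u \<Longrightarrow> yields P [Inl A] u"
  using yields_Inl[OF _ _ yields_Nil] by fastforce

lemma yields_Cons_Inl: "yields P [Inl A] u \<Longrightarrow> yields P \<alpha> w \<Longrightarrow> yields P (Inl A # \<alpha>) (u @ w)"
  using yields_append[of P "[Inl A]" u \<alpha> w] by simp

text \<open>Induction from the first rewriting step: the word splits around the replaced factor, and
  the piece derived from \<gamma> becomes the piece derived from \<open>A\<close>.\<close>

lemma derives_imp_yields: "(derive1 P)\<^sup>*\<^sup>* \<alpha> (map Inr w) \<Longrightarrow> yields P \<alpha> w"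
proof (induction rule: converse_rtranclp_induct)
  case base
  show ?case by (rule yields_map_Inr)
next
  case (step \<alpha> \<beta>)
  from step.hyps(1) show ?case
  proof cases
    case (1 A \<gamma> u v)
    from step.IH 1(2) obtain w1 w2 w3 where
      "w = w1 @ w2 @ w3" "yields P u w1" "yields P \<gamma> w2" "yields P v w3"
      by (metis yields_append_split)
    with 1(1,3) show ?thesis by (simp add: yields_append yields_Inl)
  qed
qed

lemma derive1_context: "derive1 P \<alpha> \<beta> \<Longrightarrow> derive1 P (u @ \<alpha> @ v) (u @ \<beta> @ v)"
proof (induction rule: derive1.induct)
  case (1 A \<alpha> u' v')
  from derive1.intros[OF this, of "u @ u'" "v' @ v"] show ?case by simp
qed

lemma derives_context: "(derive1 P)\<^sup>*\<^sup>* \<alpha> \<beta> \<Longrightarrow> (derive1 P)\<^sup>*\<^sup>* (u @ \<alpha> @ v) (u @ \<beta> @ v)"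
  by (induction rule: rtranclp_induct) (auto intro: rtranclp.intros derive1_context)

text \<open>The leftmost nonterminal is expanded and its subderivation completed before the rest is
  touched; \<open>derives_context\<close> embeds the subderivations.\<close>

lemma yields_imp_derives: "yields P \<alpha> w \<Longrightarrow> (derive1 P)\<^sup>*\<^sup>* \<alpha> (map Inr w)"
proof (induction rule: yields.induct)
  case yields_Nil
  show ?case by simp
next
  case (yields_Inr \<alpha> w t)
  from derives_context[OF yields_Inr.IH, of "[Inr t]" "[]"] show ?case by simp
next
  case (yields_Inl A \<gamma> u \<alpha> w)
  have "derive1 P (Inl A # \<alpha>) (\<gamma> @ \<alpha>)"
    using derive1.intros[OF yields_Inl.hyps(1), of "[]" \<alpha>] by simp
  moreover have "(derive1 P)\<^sup>*\<^sup>* (\<gamma> @ \<alpha>) (map Inr u @ \<alpha>)"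
    using derives_context[OF yields_Inl.IH(1), of "[]" \<alpha>] by simp
  moreover have "(derive1 P)\<^sup>*\<^sup>* (map Inr u @ \<alpha>) (map Inr (u @ w))"
    using derives_context[OF yields_Inl.IH(2), of "map Inr u" "[]"] by simp
  ultimately show ?case by (meson converse_rtranclp_into_rtranclp rtranclp_trans)
qed

lemma cfg_language_yields: "cfg_language P S = {w. yields P [Inl S] w}"
  unfolding cfg_language_def using derives_imp_yields yields_imp_derives by blast

section \<open>Grammar morphisms and grammars as systems of inclusions\<close>

text \<open>A map of nonterminals that sends productions to productions is a morphism of grammars.
  It gives one inclusion of languages only, so a renaming needs a morphism in each
  direction.\<close>

lemma yields_map:
  assumes "yields P \<alpha> w" "\<And>A \<gamma>. (A, \<gamma>) \<in> P \<Longrightarrow> (f A, map (map_sum f id) \<gamma>) \<in> P'"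
  shows "yields P' (map (map_sum f id) \<alpha>) w"
  using assms(1)
proof (induction rule: yields.induct)
  case (yields_Inl A \<gamma> u \<alpha> w)
  from yields.yields_Inl[OF assms(2)[OF yields_Inl.hyps(1)] yields_Inl.IH] show ?case by simp
qed (auto intro: yields.intros)

text \<open>With \<open>D\<close> assigning a candidate language to every nonterminal, a grammar
  becomes a system of inclusions \<open>sf_lang D \<gamma> \<subseteq> D A\<close>, one for each
  production.\<close>

fun sf_lang :: "('n \<Rightarrow> 't list set) \<Rightarrow> ('n + 't) list \<Rightarrow> 't list set" where
  "sf_lang D [] = {[]}"
| "sf_lang D (Inl A # \<alpha>) = {u @ w | u w. u \<in> D A \<and> w \<in> sf_lang D \<alpha>}"
| "sf_lang D (Inr t # \<alpha>) = Cons t ` sf_lang D \<alpha>"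

text \<open>The derived languages are the least solution of the system, so every solution
  \<open>D\<close> bounds them from above. Soundness of a constructed grammar thereby reduces to a
  check of one production at a time.\<close>

lemma yields_sf_lang:
  assumes "yields P \<alpha> w" "\<And>A \<gamma>. (A, \<gamma>) \<in> P \<Longrightarrow> sf_lang D \<gamma> \<subseteq> D A"
  shows "w \<in> sf_lang D \<alpha>"
  using assms(1)
proof (induction rule: yields.induct)
  case (yields_Inl A \<gamma> u \<alpha> w)
  with assms(2) have "u \<in> D A" by blast
  with yields_Inl.IH(2) show ?case by auto
qed auto

lemma yields_Inl_subset:
  assumes "yields P [Inl S] w" "\<And>A \<gamma>. (A, \<gamma>) \<in> P \<Longrightarrow> sf_lang D \<gamma> \<subseteq> D A"
  shows "w \<in> D S"
  using yields_sf_lang[OF assms] by simp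

lemma sf_lang_map_Inr_append: "sf_lang D (map Inr x @ \<alpha>) = (\<lambda>w. x @ w) ` sf_lang D \<alpha>"
  by (induction x) (auto simp: image_iff)

lemma sf_lang_yields: "w \<in> sf_lang (\<lambda>A. {u. yields P [Inl A] u}) \<alpha> \<Longrightarrow> yields P \<alpha> w"
  by (induction "\<lambda>A. {u. yields P [Inl A] u}" \<alpha> arbitrary: w rule: sf_lang.induct)
    (auto intro: yields.intros yields_Cons_Inl)

definition syms :: "('n + 't) list \<Rightarrow> 'n set" where
  "syms \<alpha> = {A. Inl A \<in> set \<alpha>}"

lemma finite_syms: "finite (syms \<alpha>)"
proof -
  have "syms \<alpha> \<subseteq> projl ` set \<alpha>" unfolding syms_def by force
  then show ?thesis by (rule finite_subset) simp
qed

section \<open>Renaming of nonterminals and finite unions\<close>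

text \<open>Allows nonterminals of any type: only finitely many occur, and an injection of these
  into the natural numbers transports the grammar.\<close>

lemma context_free_languageI:
  fixes P :: "('n, 't) prods"
  assumes "finite \<Sigma>" "finite P" "\<And>A \<alpha>. (A, \<alpha>) \<in> P \<Longrightarrow> set \<alpha> \<subseteq> Sum_Type.Plus UNIV \<Sigma>"
  shows "context_free_language \<Sigma> {w. yields P [Inl S] w}"
proof -
  \<comment> \<open>\<open>S\<close> is added because it may occur in no production.\<close>
  define N where "N = insert S (\<Union>(A, \<alpha>)\<in>P. insert A (syms \<alpha>))"
  have "finite N" unfolding N_def using assms(2) finite_syms by auto
  then obtain f :: "'n \<Rightarrow> nat" where f: "inj_on f N"
    using finite_imp_inj_to_nat_seg by blast
  define g where "g = inv_into N f"
  have gf: "g (f A) = A" if "A \<in> N" for A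
    using f that by (simp add: g_def)
  define P' where "P' = (\<lambda>(A, \<alpha>). (f A, map (map_sum f id) \<alpha>)) ` P"
  \<comment> \<open>\<open>g\<close> inverts \<open>f\<close> only on \<open>N\<close>, so the way
    back is a morphism on \<open>P'\<close> because all symbols of its productions come from
    \<open>N\<close>.\<close>
  have inv: "(g A, map (map_sum g id) \<gamma>) \<in> P" if "(A, \<gamma>) \<in> P'" for A \<gamma>
  proof -
    from that obtain B \<alpha> where B: "(B, \<alpha>) \<in> P" "A = f B" "\<gamma> = map (map_sum f id) \<alpha>"
      unfolding P'_def by auto
    have "map (map_sum g id) \<gamma> = map id \<alpha>"
      unfolding B(3) map_map
    proof (rule map_cong[OF refl])
      fix Z assume Z: "Z \<in> set \<alpha>"
      show "(map_sum g id \<circ> map_sum f id) Z = id Z"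
      proof (cases Z)
        case (Inl C)
        then have "C \<in> N" using Z B(1) unfolding N_def syms_def by auto
        then show ?thesis using Inl gf by simp
      qed simp
    qed
    moreover have "g A = B" using B gf unfolding N_def by auto
    ultimately show ?thesis using B(1) by simp
  qed
  have eq: "yields P' [Inl (f S)] w \<longleftrightarrow> yields P [Inl S] w" for w
  proof
    assume "yields P' [Inl (f S)] w"
    then have "yields P (map (map_sum g id) [Inl (f S)]) w"
      by (rule yields_map) (rule inv)
    then show "yields P [Inl S] w" using gf[of S] unfolding N_def by simp
  next
    assume "yields P [Inl S] w"
    then have "yields P' (map (map_sum f id) [Inl S]) w"
      by (rule yields_map) (auto simp: P'_def)
    then show "yields P' [Inl (f S)] w" by simp
  qed
  have "finite P'" unfolding P'_def using assms(2) by simp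
  moreover have "\<forall>(A, \<alpha>)\<in>P'. set \<alpha> \<subseteq> Sum_Type.Plus UNIV \<Sigma>"
    unfolding P'_def using assms(3) by (fastforce simp: map_sum_def split: sum.splits)
  ultimately show ?thesis
    unfolding context_free_language_def cfg_language_yields using assms(1) eq by blast
qed

lemma context_free_languageE:
  assumes "context_free_language \<Sigma> L"
  obtains P :: "(nat, 't) prods" and S where
    "finite \<Sigma>" "finite P" "\<And>A \<alpha>. (A, \<alpha>) \<in> P \<Longrightarrow> set \<alpha> \<subseteq> Sum_Type.Plus UNIV \<Sigma>" "L = {w. yields P [Inl S] w}"
  using assms unfolding context_free_language_def cfg_language_yields by fast

text \<open>The grammars are made disjoint by tagging nonterminals with the index; the new start
  symbol \<open>None\<close> chooses one of them.\<close>

lemma context_free_language_UN: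
  assumes "finite \<Sigma>" "finite I" "\<And>i. i \<in> I \<Longrightarrow> context_free_language \<Sigma> (L i)"
  shows "context_free_language \<Sigma> (\<Union>i\<in>I. L i)"
proof -
  have "\<forall>i\<in>I. \<exists>P S. finite P \<and> (\<forall>(A, \<alpha>) \<in> P. set \<alpha> \<subseteq> Sum_Type.Plus UNIV \<Sigma>) \<and> L i = {w. yields P [Inl (S::nat)] w}"
    using assms(3) unfolding context_free_language_def cfg_language_yields by blast
  then obtain P S where
    fin: "\<And>i. i \<in> I \<Longrightarrow> finite (P i)" and
    alph: "\<And>i A \<alpha>. i \<in> I \<Longrightarrow> (A, \<alpha>) \<in> P i \<Longrightarrow> set \<alpha> \<subseteq> Sum_Type.Plus UNIV \<Sigma>" and
    L: "\<And>i. i \<in> I \<Longrightarrow> L i = {w. yields (P i) [Inl (S i :: nat)] w}"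
    by (metis (mono_tags, lifting) bchoice case_prodD)
  let ?r = "\<lambda>i \<alpha>. map (map_sum (\<lambda>A. Some (i, A)) id) \<alpha>"
  define R where "R = (\<lambda>i. (None, [Inl (Some (i, S i))])) ` I \<union>
    (\<Union>i\<in>I. (\<lambda>(A, \<alpha>). (Some (i, A), ?r i \<alpha>)) ` P i)"
  \<comment> \<open>A solution of the inclusions for \<open>R\<close>: the union at
    \<open>None\<close>, the languages of the single grammars at the tagged copies.\<close>
  define D where "D Z = (case Z of None \<Rightarrow> \<Union>i\<in>I. L i | Some (i, A) \<Rightarrow> {w. yields (P i) [Inl A] w})" for Z
  have sf: "sf_lang D (?r i \<alpha>) = sf_lang (\<lambda>A. {w. yields (P i) [Inl A] w}) \<alpha>" for i \<alpha>
    by (induction "\<lambda>A. {w. yields (P i) [Inl A] w}" \<alpha> rule: sf_lang.induct) (simp_all add: D_def)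
  have "(\<Union>i\<in>I. L i) = {w. yields R [Inl None] w}"
  proof (intro equalityI subsetI)
    fix w assume "w \<in> (\<Union>i\<in>I. L i)"
    then obtain i where i: "i \<in> I" "yields (P i) [Inl (S i)] w" using L by auto
    have "yields R (?r i [Inl (S i)]) w"
      by (rule yields_map[OF i(2)]) (use i(1) in \<open>force simp: R_def\<close>)
    moreover have "(None, [Inl (Some (i, S i))]) \<in> R" using i unfolding R_def by blast
    ultimately show "w \<in> {w. yields R [Inl None] w}" using yields_single by fastforce
  next
    fix w assume "w \<in> {w. yields R [Inl None] w}"
    then have "yields R [Inl None] w" by simp
    then have "w \<in> D None"
    proof (rule yields_Inl_subset)
      fix A \<gamma> assume "(A, \<gamma>) \<in> R"
      then consider i where "i \<in> I" "A = None" "\<gamma> = [Inl (Some (i, S i))]"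
        | i B \<alpha> where "i \<in> I" "(B, \<alpha>) \<in> P i" "A = Some (i, B)" "\<gamma> = ?r i \<alpha>"
        unfolding R_def by auto
      then show "sf_lang D \<gamma> \<subseteq> D A"
      proof cases
        case 1
        then show ?thesis using L by (auto simp: D_def)
      next
        case 2
        then show ?thesis
          unfolding 2(3,4) sf using 2(2) by (auto dest!: sf_lang_yields simp: D_def intro: yields_single)
      qed
    qed
    then show "w \<in> (\<Union>i\<in>I. L i)" by (simp add: D_def)
  qed
  moreover have "context_free_language \<Sigma> {w. yields R [Inl None] w}"
  proof (rule context_free_languageI[OF assms(1)])
    show "finite R" unfolding R_def using assms(2) fin by auto
    fix A \<gamma> assume "(A, \<gamma>) \<in> R"
    then show "set \<gamma> \<subseteq> Sum_Type.Plus UNIV \<Sigma>"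
      unfolding R_def using alph by (fastforce simp: map_sum_def split: sum.splits)
  qed
  ultimately show ?thesis by simp
qed

section \<open>Finite transducers\<close>

text \<open>Reading and writing are separate moves, so that each kind gets its own productions in
  the triple grammar.\<close>

inductive accepting_run ::
    "('q \<times> 's list \<times> 'q) set \<Rightarrow> ('q \<times> 't \<times> 'q) set \<Rightarrow> 'q set \<Rightarrow> 'q \<Rightarrow> 't list \<Rightarrow> 's list \<Rightarrow> bool"
  for E M F where
  run_final: "p \<in> F \<Longrightarrow> accepting_run E M F p [] []"
| run_write: "(p, x, q) \<in> E \<Longrightarrow> accepting_run E M F q y w \<Longrightarrow> accepting_run E M F p y (x @ w)"
| run_read: "(p, t, q) \<in> M \<Longrightarrow> accepting_run E M F q y w \<Longrightarrow> accepting_run E M F p (t # y) w"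

text \<open>
  \<open>Triple p Z q\<close> generates the outputs produced by going from \<open>p\<close> to \<open>q\<close> while reading a word
  derived from \<open>Z\<close>; \<open>Tail p\<close> generates the outputs produced from \<open>p\<close> without reading.
\<close>

datatype ('q, 'n, 't) triple = Start | Tail 'q | Triple 'q "'n + 't" 'q

text \<open>Guesses the states between the symbols of a right-hand side; the second component is the
  state in which the guess ends.\<close>

primrec triple_paths :: "'q set \<Rightarrow> 'q \<Rightarrow> ('n + 't) list \<Rightarrow> ((('q, 'n, 't) triple + 's) list \<times> 'q) set" where
  "triple_paths Q p [] = {([], p)}"
| "triple_paths Q p (Z # \<alpha>) =
    (\<Union>r\<in>Q. (\<lambda>(\<beta>, e). (Inl (Triple p Z r) # \<beta>, e)) ` triple_paths Q r \<alpha>)"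

lemma finite_triple_paths: "finite Q \<Longrightarrow> finite (triple_paths Q p \<alpha>)"
  by (induction \<alpha> arbitrary: p) auto

lemma triple_paths_alphabet: "(\<beta>, e) \<in> triple_paths Q p \<alpha> \<Longrightarrow> set \<beta> \<subseteq> Sum_Type.Plus UNIV \<Sigma>"
proof (induction \<alpha> arbitrary: p \<beta>)
  case (Cons Z \<alpha>)
  from Cons.prems obtain r \<beta>' where "\<beta> = Inl (Triple p Z r) # \<beta>'" "(\<beta>', e) \<in> triple_paths Q r \<alpha>" by auto
  with Cons.IH show ?case by (simp add: InlI)
qed simp

text \<open>Output written before a letter is read is charged to the triple of that letter, and
  output after the last letter to \<open>Tail\<close>. In \<open>triple_write\<close> the transition
  \<open>(p', t, q')\<close> only ensures that \<open>t\<close> is one of the finitely many readable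
  letters, which keeps the grammar finite.\<close>

inductive_set triple_prods ::
    "'q set \<Rightarrow> ('q \<times> 's list \<times> 'q) set \<Rightarrow> ('q \<times> 't \<times> 'q) set \<Rightarrow> 'q set \<Rightarrow> 'q
      \<Rightarrow> ('n, 't) prods \<Rightarrow> 'n \<Rightarrow> (('q, 'n, 't) triple, 's) prods"
  for Q E M F q\<^sub>0 P S where
  start: "r \<in> Q \<Longrightarrow> (Start, [Inl (Triple q\<^sub>0 (Inl S) r), Inl (Tail r)]) \<in> triple_prods Q E M F q\<^sub>0 P S"
| tail_final: "p \<in> Q \<Longrightarrow> p \<in> F \<Longrightarrow> (Tail p, []) \<in> triple_prods Q E M F q\<^sub>0 P S"
| tail_write: "(p, x, q) \<in> E \<Longrightarrow>
    (Tail p, map Inr x @ [Inl (Tail q)]) \<in> triple_prods Q E M F q\<^sub>0 P S"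
| triple_read: "(p, t, q) \<in> M \<Longrightarrow> (Triple p (Inr t) q, []) \<in> triple_prods Q E M F q\<^sub>0 P S"
| triple_write: "(p, x, q) \<in> E \<Longrightarrow> (p', t, q') \<in> M \<Longrightarrow> r \<in> Q \<Longrightarrow>
    (Triple p (Inr t) r, map Inr x @ [Inl (Triple q (Inr t) r)]) \<in> triple_prods Q E M F q\<^sub>0 P S"
| triple_expand: "(A, \<alpha>) \<in> P \<Longrightarrow> p \<in> Q \<Longrightarrow> (\<beta>, e) \<in> triple_paths Q p \<alpha> \<Longrightarrow>
    (Triple p (Inl A) e, \<beta>) \<in> triple_prods Q E M F q\<^sub>0 P S"

section \<open>Correctness of the triple construction\<close>

locale transducer =
  fixes Q :: "'q set" and E :: "('q \<times> 's list \<times> 'q) set" and M :: "('q \<times> 't \<times> 'q) set"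
    and F :: "'q set" and q\<^sub>0 :: 'q and P :: "('n, 't) prods" and S :: 'n
  assumes finite_Q: "finite Q" and finite_E: "finite E" and finite_M: "finite M"
    and E_states: "E \<subseteq> Q \<times> UNIV \<times> Q" and M_states: "M \<subseteq> Q \<times> UNIV \<times> Q"
    and q\<^sub>0: "q\<^sub>0 \<in> Q" and finite_P: "finite P"
begin

abbreviation "run \<equiv> accepting_run E M F"
abbreviation "P' \<equiv> triple_prods Q E M F q\<^sub>0 P S"

lemma finite_triple_prods: "finite P'"
proof (rule finite_subset)
  let ?start = "(\<lambda>r. (Start, [Inl (Triple q\<^sub>0 (Inl S) r), Inl (Tail r)])) ` Q"
  let ?tail_final = "(\<lambda>p. (Tail p, [])) ` Q"
  let ?tail_write = "(\<lambda>(p, x, q). (Tail p, map Inr x @ [Inl (Tail q)])) ` E"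
  let ?triple_read = "(\<lambda>(p, t, q). (Triple p (Inr t) q, [])) ` M"
  let ?triple_write = "(\<lambda>((p, x, q), (p', t, q'), r).
    (Triple p (Inr t) r, map Inr x @ [Inl (Triple q (Inr t) r)])) ` (E \<times> M \<times> Q)"
  let ?triple_expand = "\<Union>(A, \<alpha>)\<in>P. \<Union>p\<in>Q. (\<lambda>(\<beta>, e). (Triple p (Inl A) e, \<beta>)) ` triple_paths Q p \<alpha>"
  let ?all = "?start \<union> (?tail_final \<union> (?tail_write \<union> (?triple_read \<union> (?triple_write \<union> ?triple_expand))))"
  show "finite ?all"
    using finite_Q finite_E finite_M finite_P
    by (intro finite_UnI finite_imageI finite_cartesian_product finite_UN_I)
      (auto simp: finite_triple_paths)
  show "P' \<subseteq> ?all"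
  proof
    fix \<rho> assume \<rho>: "\<rho> \<in> P'"
    obtain Z \<gamma> where "\<rho> = (Z, \<gamma>)" by (cases \<rho>)
    from \<rho>[unfolded this] have "(Z, \<gamma>) \<in> ?all"
    proof cases
      case (start r)
      have "(Z, \<gamma>) \<in> ?start"
        by (rule image_eqI[of _ _ r]) (use start in simp_all)
      then show ?thesis by (rule UnI1)
    next
      case (tail_final p)
      have "(Z, \<gamma>) \<in> ?tail_final"
        by (rule image_eqI[of _ _ p]) (use tail_final in simp_all)
      then show ?thesis by (intro UnI2[OF UnI1])
    next
      case (tail_write p x q)
      have "(Z, \<gamma>) \<in> ?tail_write"
        by (rule image_eqI[of _ _ "(p, x, q)"]) (use tail_write in simp_all)
      then show ?thesis by (intro UnI2[OF UnI2[OF UnI1]])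
    next
      case (triple_read p t q)
      have "(Z, \<gamma>) \<in> ?triple_read"
        by (rule image_eqI[of _ _ "(p, t, q)"]) (use triple_read in simp_all)
      then show ?thesis by (intro UnI2[OF UnI2[OF UnI2[OF UnI1]]])
    next
      case (triple_write p x q p' t q' r)
      have "(Z, \<gamma>) \<in> ?triple_write"
        by (rule image_eqI[of _ _ "((p, x, q), (p', t, q'), r)"]) (use triple_write in simp_all)
      then show ?thesis by (intro UnI2[OF UnI2[OF UnI2[OF UnI2[OF UnI1]]]])
    next
      case (triple_expand A \<alpha> p e)
      have "(Z, \<gamma>) \<in> (\<lambda>(\<beta>, e). (Triple p (Inl A) e, \<beta>)) ` triple_paths Q p \<alpha>"
        by (rule image_eqI[of _ _ "(\<gamma>, e)"]) (use triple_expand in simp_all)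
      with triple_expand(3) have
        "(Z, \<gamma>) \<in> (\<Union>p\<in>Q. (\<lambda>(\<beta>, e). (Triple p (Inl A) e, \<beta>)) ` triple_paths Q p \<alpha>)"
        by (rule UN_I)
      then have "(Z, \<gamma>) \<in> ?triple_expand"
        by (intro UN_I[OF triple_expand(2)]) simp
      then show ?thesis by (intro UnI2[OF UnI2[OF UnI2[OF UnI2[OF UnI2]]]])
    qed
    then show "\<rho> \<in> ?all" unfolding \<open>\<rho> = (Z, \<gamma>)\<close> .
  qed
qed

lemma triple_prods_alphabet:
  assumes "E \<subseteq> UNIV \<times> lists \<Sigma> \<times> UNIV" "(A, \<alpha>) \<in> P'"
  shows "set \<alpha> \<subseteq> Sum_Type.Plus UNIV \<Sigma>"
proof -
  have lists: "set (map Inr x @ [Inl B]) \<subseteq> Sum_Type.Plus UNIV \<Sigma>" if "(p, x, q) \<in> E"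
    for p x q and B :: "('q, 'n, 't) triple"
    using assms(1) that by (auto intro!: InlI InrI)
  from assms(2) show ?thesis
    by cases (use lists in \<open>simp_all add: triple_paths_alphabet InlI\<close>)
qed

text \<open>The run is cut immediately after its first reading move; all earlier moves are writing
  moves and account for \<open>w1\<close>.\<close>

lemma yields_Triple_Inr:
  assumes "run p y w" "y = t # z" "p \<in> Q"
  shows "\<exists>r\<in>Q. \<exists>w1 w2. w = w1 @ w2 \<and> yields P' [Inl (Triple p (Inr t) r)] w1 \<and> run r z w2"
  using assms
proof (induction rule: accepting_run.induct)
  case (run_write p x q y w)
  then have "q \<in> Q" using E_states by auto
  with run_write obtain r w1 w2 where r: "r \<in> Q" "w = w1 @ w2" "run r z w2"
    "yields P' [Inl (Triple q (Inr t) r)] w1" by blast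
  \<comment> \<open>The run from \<open>q\<close> still has to read \<open>t\<close>, so
    \<open>t\<close> labels some transition in \<open>M\<close>, as \<open>triple_write\<close>
    demands.\<close>
  from run_write.hyps(2) run_write.prems(1) have "\<exists>p' q'. (p', t, q') \<in> M"
    by (induction rule: accepting_run.induct) auto
  then obtain p' q' where "(p', t, q') \<in> M" by blast
  then have "(Triple p (Inr t) r, map Inr x @ [Inl (Triple q (Inr t) r)]) \<in> P'"
    using run_write.hyps(1) r(1) triple_write by metis
  then have "yields P' [Inl (Triple p (Inr t) r)] (x @ w1)"
    by (rule yields_single) (intro yields_append yields_map_Inr r)
  with r show ?case by (intro bexI[of _ r] exI[of _ "x @ w1"] exI[of _ w2]) simp_all
next
  case (run_read p t' q y w)
  then have eq: "t' = t" "y = z" by simp_all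
  have "q \<in> Q" using M_states run_read.hyps(1) by auto
  moreover have "(Triple p (Inr t) q, []) \<in> P'"
    using run_read.hyps(1) eq triple_read by metis
  then have "yields P' [Inl (Triple p (Inr t) q)] []" by (rule yields_single) (rule yields_Nil)
  ultimately show ?case using run_read.hyps(2) eq
    by (intro bexI[of _ q] exI[of _ "[]"] exI[of _ w]) simp_all
qed simp

lemma yields_Tail: "run p y w \<Longrightarrow> y = [] \<Longrightarrow> p \<in> Q \<Longrightarrow> yields P' [Inl (Tail p)] w"
proof (induction rule: accepting_run.induct)
  case (run_final p)
  then have "(Tail p, []) \<in> P'" by (intro tail_final)
  then show ?case by (rule yields_single) (rule yields_Nil)
next
  case (run_write p x q y w)
  then have "yields P' [Inl (Tail q)] w" using E_states by auto
  moreover have "(Tail p, map Inr x @ [Inl (Tail q)]) \<in> P'"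
    using run_write.hyps(1) by (rule tail_write)
  ultimately show ?case using yields_single yields_append yields_map_Inr by metis
qed simp

text \<open>Completeness: the run is cut wherever the derivation of \<open>y\<close> is cut. The
  arbitrary suffix \<open>z\<close> lets the run continue with what the remaining symbols
  derive.\<close>

lemma yields_triple_path:
  assumes "yields P \<alpha> y" "run p (y @ z) w" "p \<in> Q"
  shows "\<exists>r\<in>Q. \<exists>\<beta> w1 w2. w = w1 @ w2 \<and> (\<beta>, r) \<in> triple_paths Q p \<alpha> \<and> yields P' \<beta> w1 \<and> run r z w2"
  using assms
proof (induction arbitrary: p z w rule: yields.induct)
  case yields_Nil
  then show ?case by (intro bexI[of _ p] exI[of _ "[]"] exI[of _ w]) (auto intro: yields.yields_Nil)
next
  case (yields_Inr \<alpha> y t)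
  then have "run p (t # (y @ z)) w" by simp
  then obtain r w1 w2 where r: "r \<in> Q" "w = w1 @ w2" "yields P' [Inl (Triple p (Inr t) r)] w1" "run r (y @ z) w2"
    using yields_Triple_Inr yields_Inr.prems(2) by blast
  then obtain r' \<beta> v1 v2 where "r' \<in> Q" "w2 = v1 @ v2" "(\<beta>, r') \<in> triple_paths Q r \<alpha>" "yields P' \<beta> v1" "run r' z v2"
    using yields_Inr.IH by blast
  with r show ?case
    by (intro bexI[of _ r'] exI[of _ "Inl (Triple p (Inr t) r) # \<beta>"] exI[of _ "w1 @ v1"] exI[of _ v2])
      (auto intro!: yields_Cons_Inl)
next
  case (yields_Inl A \<gamma> u \<alpha> y)
  then have "run p (u @ (y @ z)) w" by simp
  then obtain r \<delta> w1 w2 where r: "r \<in> Q" "w = w1 @ w2" "(\<delta>, r) \<in> triple_paths Q p \<gamma>" "yields P' \<delta> w1" "run r (y @ z) w2"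
    using yields_Inl.IH(1) yields_Inl.prems(2) by blast
  then obtain r' \<beta> v1 v2 where "r' \<in> Q" "w2 = v1 @ v2" "(\<beta>, r') \<in> triple_paths Q r \<alpha>" "yields P' \<beta> v1" "run r' z v2"
    using yields_Inl.IH(2) by blast
  moreover have "(Triple p (Inl A) r, \<delta>) \<in> P'"
    using yields_Inl.hyps(1) yields_Inl.prems(2) r(3) by (rule triple_expand)
  then have "yields P' [Inl (Triple p (Inl A) r)] w1" using r(4) by (rule yields_single)
  ultimately show ?case using r
    by (intro bexI[of _ r'] exI[of _ "Inl (Triple p (Inl A) r) # \<beta>"] exI[of _ "w1 @ v1"] exI[of _ v2])
      (auto intro!: yields_Cons_Inl)
qed

text \<open>The solution that proves soundness. A run from \<open>p\<close> to \<open>q\<close> need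
  not be accepting, so it is expressed by its effect of prolonging every accepting run from
  \<open>q\<close>. This is vacuous if \<open>q\<close> has none, which does no harm: the production
  of \<open>Start\<close> supplies an accepting run through \<open>Tail\<close>.\<close>

definition outputs :: "('q, 'n, 't) triple \<Rightarrow> 's list set" where
  "outputs Z = (case Z of
      Start \<Rightarrow> {w. \<exists>y. yields P [Inl S] y \<and> run q\<^sub>0 y w}
    | Tail p \<Rightarrow> {w. run p [] w}
    | Triple p Y q \<Rightarrow> {w. \<exists>y. yields P [Y] y \<and> (\<forall>z v. run q z v \<longrightarrow> run p (y @ z) (w @ v))})"

text \<open>Prolongations of accepting runs compose along the guessed states, from the last symbol
  back to the first.\<close>

lemma sf_lang_triple_path:
  assumes "(\<beta>, e) \<in> triple_paths Q p \<alpha>" "w \<in> sf_lang outputs \<beta>"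
  shows "\<exists>y. yields P \<alpha> y \<and> (\<forall>z v. run e z v \<longrightarrow> run p (y @ z) (w @ v))"
  using assms
proof (induction \<alpha> arbitrary: \<beta> p w)
  case Nil
  then show ?case by (auto intro: yields_Nil)
next
  case (Cons Z \<alpha>)
  then obtain r \<beta>' where r: "\<beta> = Inl (Triple p Z r) # \<beta>'" "(\<beta>', e) \<in> triple_paths Q r \<alpha>" by auto
  with Cons.prems(2) obtain u w' where u: "w = u @ w'" "u \<in> outputs (Triple p Z r)" "w' \<in> sf_lang outputs \<beta>'"
    by auto
  from Cons.IH[OF r(2) u(3)] obtain y where
    y: "yields P \<alpha> y" "\<And>z v. run e z v \<Longrightarrow> run r (y @ z) (w' @ v)" by blast
  from u(2) obtain y' where
    y': "yields P [Z] y'" "\<And>z v. run r z v \<Longrightarrow> run p (y' @ z) (u @ v)" unfolding outputs_def by auto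
  have "yields P (Z # \<alpha>) (y' @ y)" using yields_append[OF y'(1) y(1)] by simp
  then show ?case using y y' u(1) by (intro exI[of _ "y' @ y"]) simp
qed

text \<open>\<open>outputs\<close> satisfies the inclusion of every production. For
  \<open>Start\<close>, the prolongation is applied to the run from \<open>r\<close> that reads
  nothing more.\<close>

lemma outputs_prefixed:
  assumes "(Z, \<gamma>) \<in> P'"
  shows "sf_lang outputs \<gamma> \<subseteq> outputs Z"
proof -
  from assms show ?thesis
  proof cases
    case (start r)
    show ?thesis
    proof
      fix w assume "w \<in> sf_lang outputs \<gamma>"
      then obtain w1 w2 where w: "w = w1 @ w2" "w1 \<in> outputs (Triple q\<^sub>0 (Inl S) r)" "w2 \<in> outputs (Tail r)"
        unfolding start by auto
      then have "run r [] w2" by (simp add: outputs_def)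
      moreover from w(2) obtain y where
        "yields P [Inl S] y" "\<And>z v. run r z v \<Longrightarrow> run q\<^sub>0 (y @ z) (w1 @ v)"
        unfolding outputs_def by auto
      ultimately have "yields P [Inl S] y \<and> run q\<^sub>0 y w" using w(1) by (metis append_Nil2)
      then show "w \<in> outputs Z" unfolding start outputs_def by auto
    qed
  next
    case tail_final
    then show ?thesis by (simp add: outputs_def run_final)
  next
    case tail_write
    then show ?thesis by (auto simp: outputs_def sf_lang_map_Inr_append intro: run_write)
  next
    case (triple_read p t q)
    have "yields P [Inr t] [t]" by (intro yields.intros)
    with triple_read show ?thesis
      by (auto simp: outputs_def intro!: exI[of _ "[t]"] intro: run_read)
  next
    case (triple_write p x q p' t q' r)
    show ?thesis
    proof
      fix w assume "w \<in> sf_lang outputs \<gamma>"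
      then obtain u where u: "w = x @ u" "u \<in> outputs (Triple q (Inr t) r)"
        unfolding triple_write sf_lang_map_Inr_append by auto
      from u(2) obtain y where
        "yields P [Inr t] y" "\<And>z v. run r z v \<Longrightarrow> run q (y @ z) (u @ v)"
        unfolding outputs_def by auto
      with u(1) triple_write(3) have
        "yields P [Inr t] y \<and> (\<forall>z v. run r z v \<longrightarrow> run p (y @ z) (w @ v))"
        by (simp add: run_write)
      then show "w \<in> outputs Z" unfolding triple_write outputs_def by auto
    qed
  next
    case (triple_expand A \<alpha> p e)
    show ?thesis
    proof
      fix w assume "w \<in> sf_lang outputs \<gamma>"
      from sf_lang_triple_path[OF triple_expand(4) this] obtain y where
        "yields P \<alpha> y" "\<forall>z v. run e z v \<longrightarrow> run p (y @ z) (w @ v)" by blast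
      with yields_single[OF triple_expand(2)] show "w \<in> outputs Z"
        unfolding triple_expand outputs_def by auto
    qed
  qed
qed

lemma yields_Start: "yields P' [Inl Start] w \<longleftrightarrow> (\<exists>y. yields P [Inl S] y \<and> run q\<^sub>0 y w)"
proof
  assume "yields P' [Inl Start] w"
  then have "w \<in> outputs Start" by (rule yields_Inl_subset) (rule outputs_prefixed)
  then show "\<exists>y. yields P [Inl S] y \<and> run q\<^sub>0 y w" by (simp add: outputs_def)
next
  assume "\<exists>y. yields P [Inl S] y \<and> run q\<^sub>0 y w"
  then obtain y where "yields P [Inl S] y" "run q\<^sub>0 (y @ []) w" by auto
  \<comment> \<open>For the one-symbol form \<open>[Inl S]\<close> the path is a single triple, and
    with empty suffix the rest of the run belongs to \<open>Tail r\<close>.\<close>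
  from yields_triple_path[OF this q\<^sub>0] obtain r w1 w2 where
    r: "r \<in> Q" "w = w1 @ w2" "yields P' [Inl (Triple q\<^sub>0 (Inl S) r)] w1" "run r [] w2" by auto
  have "yields P' [Inl (Triple q\<^sub>0 (Inl S) r), Inl (Tail r)] w"
    unfolding r(2) using r yields_Tail by (intro yields_Cons_Inl) auto
  moreover have "(Start, [Inl (Triple q\<^sub>0 (Inl S) r), Inl (Tail r)]) \<in> P'"
    using r(1) by (rule start)
  ultimately show "yields P' [Inl Start] w" by (intro yields_single)
qed

end

lemma context_free_language_transduction:
  assumes "context_free_language \<Gamma> L" "finite \<Sigma>" "finite Q" "finite E" "finite M"
    "E \<subseteq> Q \<times> lists \<Sigma> \<times> Q" "M \<subseteq> Q \<times> UNIV \<times> Q" "q\<^sub>0 \<in> Q"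
  shows "context_free_language \<Sigma> {w. \<exists>y\<in>L. accepting_run E M F q\<^sub>0 y w}"
proof -
  from assms(1) obtain P S where P: "finite P" "L = {w. yields P [Inl (S::nat)] w}"
    by (rule context_free_languageE)
  interpret transducer Q E M F q\<^sub>0 P S
    using assms P(1) by unfold_locales auto
  have "{w. \<exists>y\<in>L. accepting_run E M F q\<^sub>0 y w} = {w. yields P' [Inl Start] w}"
    using yields_Start P(2) by auto
  moreover have "context_free_language \<Sigma> {w. yields P' [Inl Start] w}"
    using assms(2,6) by (intro context_free_languageI finite_triple_prods triple_prods_alphabet[of \<Sigma>]) auto
  ultimately show ?thesis by simp
qed

section \<open>Preimages of sequential functions\<close>

primrec outs :: "('q \<Rightarrow> 's \<Rightarrow> 'q) \<Rightarrow> ('q \<Rightarrow> 's \<Rightarrow> 't list) \<Rightarrow> 'q \<Rightarrow> 's list \<Rightarrow> 't list" where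
  "outs \<delta> out q [] = []"
| "outs \<delta> out q (x # w) = out q x @ outs \<delta> out (\<delta> q x) w"

text \<open>
  The sequential machine \<open>(\<delta>, out)\<close> is inverted: a state carries a buffer holding the part of
  the machine's output that still has to be read, and \<open>None\<close> marks the end of the word being
  written.
\<close>

lemma context_free_language_inverse_sequential:
  fixes \<delta> :: "'q \<Rightarrow> 's \<Rightarrow> 'q" and out :: "'q \<Rightarrow> 's \<Rightarrow> 't list"
    and u\<^sub>0 v :: "'t list"
  assumes "context_free_language \<Gamma> L" "finite \<Sigma>" "finite Q" "q\<^sub>0 \<in> Q"
    and \<delta>: "\<And>q x. q \<in> Q \<Longrightarrow> x \<in> \<Sigma> \<Longrightarrow> \<delta> q x \<in> Q"
  shows "context_free_language \<Sigma>
    {w \<in> lists \<Sigma>. foldl \<delta> q\<^sub>0 w \<in> Fin \<and> u\<^sub>0 @ outs \<delta> out q\<^sub>0 w @ v \<in> L}"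
proof -
  \<comment> \<open>\<open>W\<close> holds every word that is ever loaded into the buffer and
    \<open>R\<close> all suffixes of these words; both are finite, hence so is the state
    set.\<close>
  define W where "W = insert u\<^sub>0 (insert v ((\<lambda>(q, x). out q x) ` (Q \<times> \<Sigma>)))"
  define R where "R = (\<lambda>(x, k). drop k x) ` (SIGMA x:W. {..length x})"
  have "finite W" unfolding W_def using assms by auto
  then have finR: "finite R" unfolding R_def by auto
  have R_W: "x \<in> R" if "x \<in> W" for x
    unfolding R_def using that by (force intro!: image_eqI[of _ _ "(x, 0)"])
  have R_Nil: "[] \<in> R"
    unfolding R_def W_def by (force intro!: image_eqI[of _ _ "(u\<^sub>0, length u\<^sub>0)"])
  have R_tl: "r \<in> R" if tr: "t # r \<in> R" for t r
  proof -
    from tr obtain x k where "x \<in> W" "k \<le> length x" "t # r = drop k x" unfolding R_def by auto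
    moreover from this have "k < length x" "r = drop (Suc k) x"
      by (auto simp: drop_Suc drop_tl dest: sym intro: le_neq_implies_less)
    ultimately show ?thesis unfolding R_def by (force intro!: image_eqI[of _ _ "(x, Suc k)"])
  qed
  define QQ where "QQ = insert None (Some ` Q) \<times> R"
  \<comment> \<open>With an empty buffer the next letter is guessed and written, and the machine's
    output on it is loaded. In a state of \<open>Fin\<close> the end may be guessed instead: nothing
    is written and \<open>v\<close> is loaded.\<close>
  define E :: "(('q option \<times> 't list) \<times> 's list \<times> ('q option \<times> 't list)) set"
    where "E = (\<lambda>(q, x). ((Some q, []), [x], (Some (\<delta> q x), out q x))) ` (Q \<times> \<Sigma>) \<union>
    (\<lambda>q. ((Some q, []), [], (None, v))) ` (Q \<inter> Fin)"
  define M :: "(('q option \<times> 't list) \<times> 't \<times> ('q option \<times> 't list)) set"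
    where "M = (\<lambda>(s, r). ((s, r), hd r, (s, tl r))) ` (insert None (Some ` Q) \<times> (R - {[]}))"
  let ?run = "accepting_run E M {(None, [])}"
  \<comment> \<open>Invariant: what remains to be read is the buffer followed by the machine's
    output on what remains to be written, and then \<open>v\<close> unless the end has been guessed
    already.\<close>
  have sound: "case p of (None, r) \<Rightarrow> w = [] \<and> y = r
      | (Some q, r) \<Rightarrow> w \<in> lists \<Sigma> \<and> foldl \<delta> q w \<in> Fin \<and> y = r @ outs \<delta> out q w @ v"
    if "?run p y w" for p y w
    using that
  proof (induction rule: accepting_run.induct)
    case (run_write p x q y w)
    then show ?case unfolding E_def by auto
  next
    case (run_read p t q y w)
    then show ?case unfolding M_def by (auto split: option.splits)
  qed simp
  have read: "?run (s, r) (r @ y) w" if "r \<in> R" "s \<in> insert None (Some ` Q)" "?run (s, []) y w" for s r y w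
    using that(1)
  proof (induction r)
    case Nil
    then show ?case using that by simp
  next
    case (Cons t r)
    then have "((s, t # r), t, (s, r)) \<in> M"
      using that(2) unfolding M_def by (force intro!: image_eqI[of _ _ "(s, t # r)"])
    with Cons R_tl show ?case by (auto intro: run_read)
  qed
  have complete: "?run (Some q, []) (outs \<delta> out q w @ v) w"
    if "w \<in> lists \<Sigma>" "q \<in> Q" "foldl \<delta> q w \<in> Fin" for w q
    using that
  proof (induction w arbitrary: q)
    case Nil
    have "?run (None, v) (v @ []) []"
      by (rule read) (auto intro: R_W run_final simp: W_def)
    moreover have "((Some q, []), [], (None, v)) \<in> E" using Nil unfolding E_def by auto
    ultimately show ?case using run_write by fastforce
  next
    case (Cons x w)
    then have "out q x \<in> R" by (intro R_W) (auto simp: W_def)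
    with Cons have "?run (Some (\<delta> q x), out q x) (out q x @ outs \<delta> out (\<delta> q x) w @ v) w"
      by (intro read) (auto intro: \<delta>)
    moreover have "((Some q, []), [x], (Some (\<delta> q x), out q x)) \<in> E" using Cons unfolding E_def by auto
    ultimately show ?case using run_write by fastforce
  qed
  have "?run (Some q\<^sub>0, u\<^sub>0) y w \<longleftrightarrow>
      w \<in> lists \<Sigma> \<and> foldl \<delta> q\<^sub>0 w \<in> Fin \<and> y = u\<^sub>0 @ outs \<delta> out q\<^sub>0 w @ v" for y w
    using sound[of "(Some q\<^sub>0, u\<^sub>0)" y w] complete[of w q\<^sub>0] read[of u\<^sub>0 "Some q\<^sub>0"] R_W[of u\<^sub>0] assms(4)
    by (auto simp: W_def)
  then have "{w \<in> lists \<Sigma>. foldl \<delta> q\<^sub>0 w \<in> Fin \<and> u\<^sub>0 @ outs \<delta> out q\<^sub>0 w @ v \<in> L} =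
      {w. \<exists>y\<in>L. ?run (Some q\<^sub>0, u\<^sub>0) y w}" by auto
  also have "context_free_language \<Sigma> \<dots>"
  proof (rule context_free_language_transduction[OF assms(1,2), where Q = QQ])
    show "finite QQ" "finite E" "finite M"
      unfolding QQ_def E_def M_def using assms finR by auto
    show "E \<subseteq> QQ \<times> lists \<Sigma> \<times> QQ"
      unfolding E_def QQ_def using R_Nil \<delta> R_W by (auto simp: W_def)
    show "M \<subseteq> QQ \<times> UNIV \<times> QQ"
    proof -
      have "tl r \<in> R" if "r \<in> R" "r \<noteq> []" for r
        using R_tl[of "hd r" "tl r"] that by simp
      then show ?thesis unfolding M_def QQ_def by auto
    qed
    show "(Some q\<^sub>0, u\<^sub>0) \<in> QQ" unfolding QQ_def using assms(4) R_W by (auto simp: W_def)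
  qed
  finally show ?thesis .
qed

section \<open>Groups\<close>

text \<open>Counterpart of \<open>outs\<close> with group elements as output, so that machines can
  be described without choosing words for their labels.\<close>

primrec seq_val :: "('a, 'm) monoid_scheme \<Rightarrow> ('q \<Rightarrow> 's \<Rightarrow> 'q) \<Rightarrow> ('q \<Rightarrow> 's \<Rightarrow> 'a) \<Rightarrow> 'q \<Rightarrow> 's list \<Rightarrow> 'a" where
  "seq_val G \<delta> g q [] = \<one>\<^bsub>G\<^esub>"
| "seq_val G \<delta> g q (x # w) = g q x \<otimes>\<^bsub>G\<^esub> seq_val G \<delta> g (\<delta> q x) w"

context group
begin

lemma letter_val_closed: "A \<subseteq> carrier G \<Longrightarrow> x \<in> letters A \<Longrightarrow> letter_val G x \<in> carrier G"
  unfolding letters_def by auto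

lemma word_val_closed: "A \<subseteq> carrier G \<Longrightarrow> w \<in> lists (letters A) \<Longrightarrow> word_val G w \<in> carrier G"
  by (induction w) (auto simp: letter_val_closed)

lemma word_val_append:
  "A \<subseteq> carrier G \<Longrightarrow> u \<in> lists (letters A) \<Longrightarrow> w \<in> lists (letters A) \<Longrightarrow>
    word_val G (u @ w) = word_val G u \<otimes> word_val G w"
  by (induction u) (auto simp: letter_val_closed word_val_closed m_assoc)

lemma generate_word_val:
  assumes "A \<subseteq> carrier G" "x \<in> generate G A"
  shows "\<exists>w\<in>lists (letters A). word_val G w = x"
  using assms(2)
proof (induction rule: generate.induct)
  case one
  show ?case by (rule bexI[of _ "[]"]) auto
next
  case (incl h)
  with assms(1) show ?case by (intro bexI[of _ "[Pos h]"]) (auto simp: letters_def)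
next
  case (inv h)
  with assms(1) show ?case by (intro bexI[of _ "[Neg h]"]) (auto simp: letters_def)
next
  case (eng h1 h2)
  then obtain u w where "u \<in> lists (letters A)" "word_val G u = h1" "w \<in> lists (letters A)" "word_val G w = h2"
    by blast
  with word_val_append[OF assms(1)] show ?case by (intro bexI[of _ "u @ w"]) auto
qed

text \<open>A fixed word for each group element turns labels into output words and the factors
  \<open>c\<close> and \<open>d\<close> into a prefix and a suffix. The lemma is applied to
  \<open>G\<close> with a one-state machine and to \<open>H\<close> with the automaton of
  cosets.\<close>

lemma context_free_language_seq_val:
  fixes \<delta> :: "'q \<Rightarrow> 's \<Rightarrow> 'q"
  assumes A: "fin_gen_set G A" and cf: "context_free_language (letters A) (word_preimage G A K)"
    and fin: "finite \<Sigma>" "finite Q" and q\<^sub>0: "q\<^sub>0 \<in> Q"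
    and \<delta>: "\<And>q x. q \<in> Q \<Longrightarrow> x \<in> \<Sigma> \<Longrightarrow> \<delta> q x \<in> Q"
    and g: "\<And>q x. q \<in> Q \<Longrightarrow> x \<in> \<Sigma> \<Longrightarrow> g q x \<in> carrier G"
    and c: "c \<in> carrier G" "d \<in> carrier G"
  shows "context_free_language \<Sigma>
    {w \<in> lists \<Sigma>. foldl \<delta> q\<^sub>0 w \<in> Fin \<and> c \<otimes> (seq_val G \<delta> g q\<^sub>0 w \<otimes> d) \<in> K}"
proof -
  have AG: "A \<subseteq> carrier G" and gen: "generate G A = carrier G"
    using A unfolding fin_gen_set_def by auto
  obtain rep where rep: "\<And>x. x \<in> carrier G \<Longrightarrow> rep x \<in> lists (letters A)"
      "\<And>x. x \<in> carrier G \<Longrightarrow> word_val G (rep x) = x"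
    using generate_word_val[OF AG] unfolding gen by metis
  let ?outs = "outs \<delta> (\<lambda>q x. rep (g q x))"
  have outs: "?outs q w \<in> lists (letters A) \<and> word_val G (?outs q w) = seq_val G \<delta> g q w"
    if "w \<in> lists \<Sigma>" "q \<in> Q" for w q
    using that by (induction w arbitrary: q) (auto simp: \<delta> g rep word_val_append[OF AG] simp del: in_lists_conv_set)
  have "rep c @ ?outs q\<^sub>0 w @ rep d \<in> word_preimage G A K \<longleftrightarrow> c \<otimes> (seq_val G \<delta> g q\<^sub>0 w \<otimes> d) \<in> K"
    if "w \<in> lists \<Sigma>" for w
    using outs[OF that q\<^sub>0] rep[OF c(1)] rep[OF c(2)]
    unfolding word_preimage_def by (simp add: word_val_append[OF AG] del: in_lists_conv_set)
  then have "{w \<in> lists \<Sigma>. foldl \<delta> q\<^sub>0 w \<in> Fin \<and> c \<otimes> (seq_val G \<delta> g q\<^sub>0 w \<otimes> d) \<in> K} =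
      {w \<in> lists \<Sigma>. foldl \<delta> q\<^sub>0 w \<in> Fin \<and> rep c @ ?outs q\<^sub>0 w @ rep d \<in> word_preimage G A K}"
    by blast
  then show ?thesis
    using context_free_language_inverse_sequential[OF cf fin q\<^sub>0 \<delta>] by simp
qed

text \<open>
  Schreier's lemma. The transversal must represent \<open>H\<close> itself by \<open>\<one>\<close>, so that the Schreier
  generators alone suffice.
\<close>

lemma schreier_finitely_generated:
  assumes A: "fin_gen_set G A" and H: "subgroup H G"
    and T: "finite T" "T \<subseteq> carrier G" "\<one> \<in> T" "T \<inter> H \<subseteq> {\<one>}"
    and cover: "\<And>x. x \<in> carrier G \<Longrightarrow> \<exists>t\<in>T. x \<otimes> inv t \<in> H"
  shows "finitely_generated (G\<lparr>carrier := H\<rparr>)"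
proof -
  interpret H: subgroup H G by (rule H)
  have AG: "A \<subseteq> carrier G" and gen: "generate G A = carrier G" and "finite A"
    using A unfolding fin_gen_set_def by auto
  \<comment> \<open>The Schreier generators: triples whose product falls outside \<open>H\<close>
    are discarded.\<close>
  define B where "B = H \<inter> (\<lambda>(c, x, d). c \<otimes> letter_val G x \<otimes> inv d) ` (T \<times> letters A \<times> T)"
  have "finite B" unfolding B_def letters_def using T(1) \<open>finite A\<close> by simp
  have BH: "B \<subseteq> H" unfolding B_def by blast
  \<comment> \<open>The word is consumed letter by letter; the representative \<open>e\<close> that
    closes one Schreier generator opens the next and cancels.\<close>
  have path: "\<exists>d\<in>T. c \<otimes> word_val G w \<otimes> inv d \<in> generate G B"
    if "w \<in> lists (letters A)" "c \<in> T" for w c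
    using that
  proof (induction w arbitrary: c)
    case Nil
    then have "c \<in> carrier G" using T(2) by blast
    then have "c \<otimes> word_val G [] \<otimes> inv c \<in> generate G B" by (simp add: generate.one)
    then show ?case using Nil.prems by blast
  next
    case (Cons x w)
    then have x: "x \<in> letters A" "letter_val G x \<in> carrier G" and w: "word_val G w \<in> carrier G" and c: "c \<in> carrier G"
      using T(2) letter_val_closed[OF AG] word_val_closed[OF AG] by auto
    obtain e where e: "e \<in> T" "c \<otimes> letter_val G x \<otimes> inv e \<in> H" using cover c x by blast
    with Cons obtain d where d: "d \<in> T" "e \<otimes> word_val G w \<otimes> inv d \<in> generate G B" by auto
    have "c \<otimes> letter_val G x \<otimes> inv e \<in> B"
      unfolding B_def using e Cons.prems x(1) by force
    from generate.eng[OF generate.incl[OF this] d(2)]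
    have "(c \<otimes> letter_val G x \<otimes> inv e) \<otimes> (e \<otimes> word_val G w \<otimes> inv d) \<in> generate G B" .
    also have "(c \<otimes> letter_val G x \<otimes> inv e) \<otimes> (e \<otimes> word_val G w \<otimes> inv d)
        = c \<otimes> word_val G (x # w) \<otimes> inv d"
    proof -
      have "e \<in> carrier G" "d \<in> carrier G" using e d T(2) by auto
      then have "inv e \<otimes> (e \<otimes> (word_val G w \<otimes> inv d)) = word_val G w \<otimes> inv d"
        using w by (simp add: m_assoc[symmetric])
      with x w c \<open>e \<in> carrier G\<close> \<open>d \<in> carrier G\<close> show ?thesis by (simp add: m_assoc)
    qed
    finally show ?case using d(1) by blast
  qed
  have "H \<subseteq> generate G B"
  proof
    fix h assume h: "h \<in> H"
    then have hG: "h \<in> carrier G" by simp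
    then obtain w where w: "w \<in> lists (letters A)" "word_val G w = h"
      using generate_word_val[OF AG] gen by blast
    from path[OF w(1) T(3)] obtain d where d: "d \<in> T" "h \<otimes> inv d \<in> generate G B"
      using w hG by auto
    have dG: "d \<in> carrier G" using d(1) T(2) by blast
    \<comment> \<open>Both \<open>h\<close> and \<open>h \<otimes> inv d\<close> lie in
      \<open>H\<close>, hence so does \<open>d\<close>; the only representative in \<open>H\<close>
      is \<one>, and the path ends at \<open>h\<close> itself.\<close>
    have "h \<otimes> inv d \<in> H"
      using d(2) generate_subgroup_incl[OF BH H] by blast
    then have "inv (h \<otimes> inv d) \<otimes> h \<in> H" using h by simp
    also have "inv (h \<otimes> inv d) \<otimes> h = d" using hG dG by (simp add: inv_mult_group m_assoc)
    finally have "d = \<one>" using d(1) T(4) by blast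
    with d(2) hG show "h \<in> generate G B" by simp
  qed
  then have "generate (G\<lparr>carrier := H\<rparr>) B = H"
    using generate_consistent[OF BH H] generate_subgroup_incl[OF BH H] by auto
  then show ?thesis
    unfolding finitely_generated_def fin_gen_set_def using \<open>finite B\<close> BH by auto
qed

section \<open>Transfer between a group and its subgroup\<close>

text \<open>Only formal inverses need care: they are evaluated with the inverse of the structure at
  hand, and the two inverses agree on \<open>H\<close>.\<close>

lemma subgroup_word_val:
  assumes "subgroup H G" "B \<subseteq> H" "w \<in> lists (letters B)"
  shows "word_val (G\<lparr>carrier := H\<rparr>) w = word_val G w \<and> word_val G w \<in> H"
proof -
  interpret subgroup H G by fact
  from assms(3) show ?thesis
    by (induction w) (use assms(2) in \<open>auto simp: letters_def m_inv_consistent[OF assms(1)] subset_iff\<close>)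
qed

lemma CF_coset_section:
  assumes "subgroup H G" "finitely_generated (G\<lparr>carrier := H\<rparr>)" "K \<in> CF G" "c \<in> carrier G"
  shows "{h \<in> H. h \<otimes> c \<in> K} \<in> CF (G\<lparr>carrier := H\<rparr>)"
proof -
  from assms(2) obtain B where B: "fin_gen_set (G\<lparr>carrier := H\<rparr>) B" unfolding finitely_generated_def by blast
  then have BH: "B \<subseteq> H" and "finite B" unfolding fin_gen_set_def by auto
  have BG: "B \<subseteq> carrier G" using BH subgroup.subset[OF assms(1)] by blast
  from assms(3) obtain A where A: "fin_gen_set G A" "context_free_language (letters A) (word_preimage G A K)"
    unfolding CF_def by blast
  \<comment> \<open>One state, with each letter labelled by its value in \<open>G\<close>: the
    machine merely evaluates the word.\<close>
  have seq: "seq_val G (\<lambda>_ _. ()) (\<lambda>_. letter_val G) q w = word_val G w" for q w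
    by (induction w) auto
  have eq: "\<one> \<otimes> (word_val G w \<otimes> c) \<in> K \<longleftrightarrow> word_val (G\<lparr>carrier := H\<rparr>) w \<in> {h \<in> H. h \<otimes> c \<in> K}"
    if "w \<in> lists (letters B)" for w
    using subgroup_word_val[OF assms(1) BH that] word_val_closed[OF BG that] assms(4) by simp
  have "context_free_language (letters B)
      {w \<in> lists (letters B). foldl (\<lambda>_ _. ()) () w \<in> UNIV \<and>
        \<one> \<otimes> (seq_val G (\<lambda>_ _. ()) (\<lambda>_. letter_val G) () w \<otimes> c) \<in> K}"
  proof (rule context_free_language_seq_val[OF A])
    show "finite (letters B)" using \<open>finite B\<close> by (simp add: letters_def)
    show "letter_val G x \<in> carrier G" if "x \<in> letters B" for x
      using letter_val_closed[OF BG that] .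
  qed (use assms(4) in auto)
  also have "{w \<in> lists (letters B). foldl (\<lambda>_ _. ()) () w \<in> UNIV \<and>
        \<one> \<otimes> (seq_val G (\<lambda>_ _. ()) (\<lambda>_. letter_val G) () w \<otimes> c) \<in> K} =
      word_preimage (G\<lparr>carrier := H\<rparr>) B {h \<in> H. h \<otimes> c \<in> K}"
    unfolding word_preimage_def seq using eq by blast
  finally show ?thesis unfolding CF_def using B by auto
qed

end

theorem proposition3p6:
  fixes G :: "('a, 'm) monoid_scheme" (structure)
    and H :: "'a set" and b :: "nat \<Rightarrow> 'a" and n :: nat
  assumes "group G"
    and "finitely_generated G"
    and "subgroup H G"
    and "finite (rcosets H)"
    and "\<And>i. i \<in> {1..n} \<Longrightarrow> b i \<in> carrier G"
    and "carrier G = (\<Union>i\<in>{1..n}. H #> b i)"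
    and "disjoint_family_on (\<lambda>i. H #> b i) {1..n}"
  shows "CF G = {\<Union>i\<in>{1..n}. L i #> b i | L. \<forall>i\<in>{1..n}. L i \<in> CF (G\<lparr>carrier := H\<rparr>)}"
proof -
  interpret group G by fact
  interpret H: subgroup H G by fact
  interpret HG: group "G\<lparr>carrier := H\<rparr>" by (rule subgroup_imp_group) fact
  let ?I = "{1..n}"
  note b = assms(5)
  have coset: "x \<in> H #> b i \<longleftrightarrow> x \<otimes> inv (b i) \<in> H" if "x \<in> carrier G" "i \<in> ?I" for x i
  proof
    assume "x \<in> H #> b i"
    then obtain h where "h \<in> H" "x = h \<otimes> b i" unfolding r_coset_def by blast
    then show "x \<otimes> inv (b i) \<in> H" using b[OF that(2)] by (simp add: m_assoc)
  next
    assume "x \<otimes> inv (b i) \<in> H"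
    moreover have "x = (x \<otimes> inv (b i)) \<otimes> b i" using that b by (simp add: m_assoc)
    ultimately show "x \<in> H #> b i" unfolding r_coset_def by blast
  qed
  have "\<forall>x\<in>carrier G. \<exists>i. i \<in> ?I \<and> x \<in> H #> b i" using assms(6) by blast
  then obtain idx where idx: "\<And>x. x \<in> carrier G \<Longrightarrow> idx x \<in> ?I"
      "\<And>x. x \<in> carrier G \<Longrightarrow> x \<in> H #> b (idx x)"
    by metis
  have idx_eq: "i = j" if "x \<in> H #> b i" "x \<in> H #> b j" "i \<in> ?I" "j \<in> ?I" for x i j
    using assms(7) that unfolding disjoint_family_on_def by blast
  from assms(2) obtain A where A: "fin_gen_set G A" unfolding finitely_generated_def by blast
  then have AG: "A \<subseteq> carrier G" and "finite A" unfolding fin_gen_set_def by auto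
  have finite_letters: "finite (letters A)" using \<open>finite A\<close> by (simp add: letters_def)
  have fgH: "finitely_generated (G\<lparr>carrier := H\<rparr>)"
  \<comment> \<open>Representatives that lie in \<open>H\<close> are traded for \<one>, as
    Schreier's lemma requires.\<close>
  proof (rule schreier_finitely_generated[OF A assms(3), of "insert \<one> (b ` ?I - H)"])
    fix x assume x: "x \<in> carrier G"
    with idx coset have *: "idx x \<in> ?I" "x \<otimes> inv (b (idx x)) \<in> H" by auto
    show "\<exists>t\<in>insert \<one> (b ` ?I - H). x \<otimes> inv t \<in> H"
    proof (cases "b (idx x) \<in> H")
      case True
      with * have "x \<otimes> inv (b (idx x)) \<otimes> b (idx x) \<in> H" by blast
      then have "x \<in> H" using x b[OF *(1)] by (simp add: m_assoc)
      then show ?thesis using x by (intro bexI[of _ \<one>]) auto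
    qed (use * in blast)
  qed (use b in auto)
  have decompose: "K = (\<Union>i\<in>?I. {h \<in> H. h \<otimes> b i \<in> K} #> b i)" if K: "K \<subseteq> carrier G" for K
  proof (intro equalityI subsetI)
    fix x assume x: "x \<in> K"
    with K idx obtain i where i: "i \<in> ?I" "x \<in> H #> b i" by blast
    then obtain h where "h \<in> H" "x = h \<otimes> b i" unfolding r_coset_def by blast
    with x have "x \<in> {h \<in> H. h \<otimes> b i \<in> K} #> b i" unfolding r_coset_def by blast
    with i(1) show "x \<in> (\<Union>i\<in>?I. {h \<in> H. h \<otimes> b i \<in> K} #> b i)" by blast
  qed (auto simp: r_coset_def)
  define \<delta> where "\<delta> i x = idx (b i \<otimes> letter_val G x)" for i x
  define g where "g i x = b i \<otimes> letter_val G x \<otimes> inv (b (\<delta> i x))" for i x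
  have \<delta>: "\<delta> i x \<in> ?I" and g: "g i x \<in> H" if "i \<in> ?I" "x \<in> letters A" for i x
  proof -
    have *: "b i \<otimes> letter_val G x \<in> carrier G" using b[OF that(1)] letter_val_closed[OF AG that(2)] by simp
    show "\<delta> i x \<in> ?I" unfolding \<delta>_def using idx * by blast
    then show "g i x \<in> H" using idx(2)[OF *] coset[OF *] unfolding g_def \<delta>_def by blast
  qed
  \<comment> \<open>Invariant of the automaton of cosets: by \<open>g i x \<otimes> b (\<delta> i x)
    = b i \<otimes> letter_val G x\<close>, the current representative moves past one letter at a
    time and leaves a factor in \<open>H\<close>.\<close>
  have run: "foldl \<delta> i w \<in> ?I \<and> seq_val G \<delta> g i w \<in> H \<and>
      seq_val G \<delta> g i w \<otimes> b (foldl \<delta> i w) = b i \<otimes> word_val G w"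
    if "w \<in> lists (letters A)" "i \<in> ?I" for w i
    using that
  proof (induction w arbitrary: i)
    case Nil
    then show ?case using b by simp
  next
    case (Cons x w)
    then have x: "x \<in> letters A" "letter_val G x \<in> carrier G" and w: "word_val G w \<in> carrier G"
      using letter_val_closed[OF AG] word_val_closed[OF AG] by auto
    have d: "\<delta> i x \<in> ?I" "g i x \<in> H" using \<delta> g x(1) Cons.prems by auto
    have IH: "foldl \<delta> (\<delta> i x) w \<in> ?I" "seq_val G \<delta> g (\<delta> i x) w \<in> H"
      "seq_val G \<delta> g (\<delta> i x) w \<otimes> b (foldl \<delta> (\<delta> i x) w) = b (\<delta> i x) \<otimes> word_val G w"
      using Cons.IH[OF d(1)] Cons.hyps by auto
    have "g i x \<otimes> seq_val G \<delta> g (\<delta> i x) w \<otimes> b (foldl \<delta> (\<delta> i x) w) = g i x \<otimes> (b (\<delta> i x) \<otimes> word_val G w)"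
      using IH d b[OF IH(1)] by (simp add: m_assoc)
    also have "\<dots> = g i x \<otimes> b (\<delta> i x) \<otimes> word_val G w"
      using d b[OF d(1)] w by (simp add: m_assoc)
    also have "g i x \<otimes> b (\<delta> i x) = b i \<otimes> letter_val G x"
      unfolding g_def using b[OF d(1)] b[OF Cons.prems] x(2) by (simp add: m_assoc)
    finally show ?case using IH d b[OF Cons.prems] x(2) w by (simp add: m_assoc)
  qed
  \<comment> \<open>The automaton starts at the coset of \<one>. Its representative need not be
    \<one>, which the factor \<open>inv (b i\<^sub>0)\<close>, an element of \<open>H\<close>,
    corrects.\<close>
  define i\<^sub>0 where "i\<^sub>0 = idx \<one>"
  have i\<^sub>0: "i\<^sub>0 \<in> ?I" "inv (b i\<^sub>0) \<in> H"
    using idx[of \<one>] coset[of \<one> i\<^sub>0] b[of i\<^sub>0] unfolding i\<^sub>0_def by auto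
  have word: "inv (b i\<^sub>0) \<otimes> seq_val G \<delta> g i\<^sub>0 w \<otimes> b (foldl \<delta> i\<^sub>0 w) = word_val G w"
    if "w \<in> lists (letters A)" for w
    using run[OF that i\<^sub>0(1)] b[OF i\<^sub>0(1)] b[of "foldl \<delta> i\<^sub>0 w"] word_val_closed[OF AG that]
    by (simp add: m_assoc) (simp add: m_assoc[symmetric])
  have seq_H: "seq_val (G\<lparr>carrier := H\<rparr>) \<delta> g i w = seq_val G \<delta> g i w" for i w
    by (induction w arbitrary: i) auto
  \<comment> \<open>The generating set \<open>A\<close> is the same for all cosets, so that the
    union can be formed over one alphabet.\<close>
  have coset_CF: "context_free_language (letters A) (word_preimage G A (L #> b i))"
    if L: "L \<in> CF (G\<lparr>carrier := H\<rparr>)" and i: "i \<in> ?I" for L i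
  proof -
    from L have LH: "L \<subseteq> H" unfolding CF_def by simp
    from L obtain B where B: "fin_gen_set (G\<lparr>carrier := H\<rparr>) B"
      "context_free_language (letters B) (word_preimage (G\<lparr>carrier := H\<rparr>) B L)"
      unfolding CF_def by blast
    have "word_val G w \<in> L #> b i \<longleftrightarrow> foldl \<delta> i\<^sub>0 w \<in> {i} \<and> inv (b i\<^sub>0) \<otimes> seq_val G \<delta> g i\<^sub>0 w \<in> L"
      if w: "w \<in> lists (letters A)" for w
    proof -
      let ?h = "inv (b i\<^sub>0) \<otimes> seq_val G \<delta> g i\<^sub>0 w" and ?f = "foldl \<delta> i\<^sub>0 w"
      have h: "?h \<in> H" "?f \<in> ?I" "?h \<otimes> b ?f = word_val G w"
        using run[OF w i\<^sub>0(1)] i\<^sub>0(2) word[OF w] by auto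
      show ?thesis
      proof
        assume "word_val G w \<in> L #> b i"
        then obtain l where l: "l \<in> L" "l \<otimes> b i = word_val G w" unfolding r_coset_def by auto
        \<comment> \<open>Disjointness of the cosets identifies the index; cancelling
          \<open>b i\<close> then identifies the factor in \<open>H\<close>.\<close>
        have "word_val G w \<in> H #> b i" "word_val G w \<in> H #> b ?f"
          using l LH h unfolding r_coset_def by force+
        then have "?f = i" using idx_eq h(2) i by blast
        moreover from this have "?h = l"
          using l h LH b[OF i] by (metis H.mem_carrier r_cancel subsetD)
        ultimately show "?f \<in> {i} \<and> ?h \<in> L" using l by simp
      next
        assume "?f \<in> {i} \<and> ?h \<in> L"
        then show "word_val G w \<in> L #> b i" using h(3) unfolding r_coset_def by force
      qed
    qed
    then have "word_preimage G A (L #> b i) =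
      {w \<in> lists (letters A). foldl \<delta> i\<^sub>0 w \<in> {i} \<and> inv (b i\<^sub>0) \<otimes> seq_val G \<delta> g i\<^sub>0 w \<in> L}"
      unfolding word_preimage_def by blast
    \<comment> \<open>Restated inside \<open>H\<close> with a trailing factor \<one>, to fit the
      form required for sequential values in the group \<open>H\<close>.\<close>
    also have "\<dots> = {w \<in> lists (letters A). foldl \<delta> i\<^sub>0 w \<in> {i} \<and>
      inv (b i\<^sub>0) \<otimes>\<^bsub>G\<lparr>carrier := H\<rparr>\<^esub> (seq_val (G\<lparr>carrier := H\<rparr>) \<delta> g i\<^sub>0 w \<otimes>\<^bsub>G\<lparr>carrier := H\<rparr>\<^esub> \<one>\<^bsub>G\<lparr>carrier := H\<rparr>\<^esub>) \<in> L}"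
    proof -
      have "seq_val G \<delta> g i\<^sub>0 w \<otimes> \<one> = seq_val G \<delta> g i\<^sub>0 w" if "w \<in> lists (letters A)" for w
        using run[OF that i\<^sub>0(1)] by simp
      then show ?thesis
        unfolding seq_H by (intro Collect_cong conj_cong refl) (simp del: in_lists_conv_set)
    qed
    also have "context_free_language (letters A) \<dots>"
      by (rule HG.context_free_language_seq_val[OF B finite_letters, where Q = ?I])
        (use i\<^sub>0 \<delta> g in auto)
    finally show ?thesis .
  qed
  show ?thesis
  proof (intro equalityI subsetI)
    fix K assume K: "K \<in> CF G"
    then have "K \<subseteq> carrier G" unfolding CF_def by simp
    moreover have "\<forall>i\<in>?I. {h \<in> H. h \<otimes> b i \<in> K} \<in> CF (G\<lparr>carrier := H\<rparr>)"
      using CF_coset_section[OF assms(3) fgH K b] by blast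
    ultimately show "K \<in> {\<Union>i\<in>?I. L i #> b i | L. \<forall>i\<in>?I. L i \<in> CF (G\<lparr>carrier := H\<rparr>)}"
      using decompose[of K]
      by (intro CollectI exI[of _ "\<lambda>i. {h \<in> H. h \<otimes> b i \<in> K}"] conjI)
  next
    fix K assume "K \<in> {\<Union>i\<in>?I. L i #> b i | L. \<forall>i\<in>?I. L i \<in> CF (G\<lparr>carrier := H\<rparr>)}"
    then obtain L where L: "K = (\<Union>i\<in>?I. L i #> b i)" "\<And>i. i \<in> ?I \<Longrightarrow> L i \<in> CF (G\<lparr>carrier := H\<rparr>)" by blast
    have "L i #> b i \<subseteq> carrier G" if "i \<in> ?I" for i
      using L(2)[OF that] b[OF that] H.subset by (intro r_coset_subset_G) (auto simp: CF_def)
    then have "K \<subseteq> carrier G" unfolding L(1) by blast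
    moreover have "word_preimage G A K = (\<Union>i\<in>?I. word_preimage G A (L i #> b i))"
      unfolding L(1) word_preimage_def by auto
    then have "context_free_language (letters A) (word_preimage G A K)"
      using context_free_language_UN[OF finite_letters, of ?I] coset_CF L(2) by simp
    ultimately show "K \<in> CF G" unfolding CF_def using A by blast
  qed
qed

end
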